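(* Pick $(a,d) \in \Omega_-$ and assume that $\overline{u}_{\mathrm{bot}}(a,d) < \overline{u}_{\mathrm{top}}(a,d)$ holds. Then we have $c(a,d) > 0$.
   Context: Let $g(u;a) = u(1-u)(u-a)$ and $G(u,v;a,d) = \big( 2d(v-u) + g(u;a),\ 2d(u-v) + g(v;a) \big)^T$; $D_{1,2}G$ is the Jacobian with respect to $(u,v)$. For $0<a<1$ let $d_-(a)$ be the threshold such that $G(\cdot,\cdot;a,d)=0$ has nine distinct real solutions for $0\le d<d_-(a)$ and fewer than nine for $d\ge d_-(a)$. Set $\Omega_- = \{(a,d): 0<a<1,\ 0<d<d_-(a)\}$. For $(a,d)\in\Omega_-$ let $(\overline{u}_B,\overline{v}_B)=(\overline{u}_B(a,d),\overline{v}_B(a,d))\in(0,1)^2$ be the unique solution of $G(u,v;a,d)=0$ with $u<a<v$ for which $D_{1,2}G$ has two strictly negative eigenvalues. For $(a,d)\in\Omega_-$ there is a unique $c=c(a,d)\in\mathbb{R}$ (and it satisfies $c\ge0$) for which there is a componentwise non-decreasing $\Phi=(\Phi_u,\Phi_v):\mathbb{R}\to\mathbb{R}^2$ satisfying $$\begin{aligned} -c\,\Phi_u'(\xi) &= d\big[\Phi_v(\xi-1) - 2\Phi_u(\xi) + \Phi_v(\xi+1)\big] + g(\Phi_u(\xi);a),\\ -c\,\Phi_v'(\xi) &= d\big[\Phi_u(\xi-1) - 2\Phi_v(\xi) + \Phi_u(\xi+1)\big] + g(\Phi_v(\xi);a) \end{aligned}$$ for all $\xi$, with $\Phi(-\infty)=(0,0)$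 and $\Phi(+\infty)=(\overline{u}_B,\overline{v}_B)$ (for $c=0$ the left-hand sides are zero and no regularity of $\Phi$ is required). Write $u_{a,d}(v) = v-\frac{g(v;a)}{2d}$, $v_{a,d}(u) = u-\frac{g(u;a)}{2d}$ and $$\gamma_{c;\pm}(a,d) = \tfrac13(a+1)\pm\tfrac13\sqrt{a^2-a+1-6d}.$$ The function $u_{a,d}$ is strictly decreasing on $[\gamma_{c;-},\gamma_{c;+}]$ and strictly increasing outside this interval. Let $\overline{v}_{\mathrm{bot}}(a,d)$ be the unique solution $v\in(0,\gamma_{c;-}(a,d))$ of $u_{a,d}(v)=\overline{u}_B(a,d)$, and let $u_{a,d}^{\mathrm{inv}}:[0,\overline{u}_B(a,d)]\to[0,\overline{v}_{\mathrm{bot}}(a,d)]$ be the inverse of the restriction of $u_{a,d}$ to $[0,\overline{v}_{\mathrm{bot}}(a,d)]$. Finally set $$\overline{u}_{\mathrm{top}}(a,d) = 2u_{a,d}\big(\gamma_{c;+}(a,d)\big)-\overline{u}_B(a,d),\qquad v_{a,d;r}(u) = 2v_{a,d}(u)-\overline{v}_B(a,d),$$ $$\overline{u}_{\mathrm{bot}}(a,d) = \max\{u\in[0,\overline{u}_B(a,d)] : v_{a,d;r}(u) = u_{a,d}^{\mathrm{inv}}(u)\}.$$ *)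

theory Defs
  imports "HOL-Analysis.Analysis"
begin

definition nagumo_g :: "real \<Rightarrow> real \<Rightarrow> real" where
  "nagumo_g u a = u * (1 - u) * (u - a)"

text \<open>A pair \<open>(u, v)\<close> is the vector \<open>vector [u, v] :: real^2\<close>, so that the library's
  \<^const>\<open>jacobian\<close> applies.\<close>

definition nagumo_G :: "real \<Rightarrow> real \<Rightarrow> real^2 \<Rightarrow> real^2" where
  "nagumo_G a d w = vector
     [2 * d * (w $ 2 - w $ 1) + nagumo_g (w $ 1) a,
      2 * d * (w $ 1 - w $ 2) + nagumo_g (w $ 2) a]"

definition eigenvalue :: "real^'n^'n \<Rightarrow> real \<Rightarrow> bool" where
  "eigenvalue A l \<longleftrightarrow> (\<exists>x. x \<noteq> 0 \<and> A *v x = l *s x)"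

text \<open>\<open>is_d_minus a D\<close> says that \<open>D = d\<^sub>-(a)\<close>. For \<open>0 < a < 1\<close> at most one
  \<open>D\<close> has this property: \<open>d = 0\<close> has nine solutions, so \<open>D > 0\<close>, and for two such values
  \<open>D < D'\<close> the parameter \<open>d = D\<close> would have both nine and fewer than nine solutions.
  \<^const>\<open>finite\<close> is needed because \<^const>\<open>card\<close> of an infinite set is \<open>0\<close>.\<close>

definition is_d_minus :: "real \<Rightarrow> real \<Rightarrow> bool" where
  "is_d_minus a D \<longleftrightarrow>
     (\<forall>d. 0 \<le> d \<and> d < D \<longrightarrow> card {w. nagumo_G a d w = 0} = 9) \<and>
     (\<forall>d. d \<ge> D \<longrightarrow> finite {w. nagumo_G a d w = 0} \<and> card {w. nagumo_G a d w = 0} < 9)"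

definition Omega_minus :: "(real \<times> real) set" where
  "Omega_minus = {(a, d). 0 < a \<and> a < 1 \<and> (\<exists>D. is_d_minus a D \<and> 0 < d \<and> d < D)}"

text \<open>The property that singles out \<open>(u\<^sub>B, v\<^sub>B)\<close>. The Jacobian is symmetric with off-diagonal
  entry \<open>2 * d \<noteq> 0\<close>, so its two eigenvalues are distinct and can be counted as a set.\<close>

definition is_uv_B :: "real \<Rightarrow> real \<Rightarrow> real \<Rightarrow> real \<Rightarrow> bool" where
  "is_uv_B a d u v \<longleftrightarrow>
     u \<in> {0<..<1} \<and> v \<in> {0<..<1} \<and>
     nagumo_G a d (vector [u, v]) = 0 \<and> u < a \<and> a < v \<and>
     card {l. eigenvalue (jacobian (nagumo_G a d) (at (vector [u, v]))) l \<and> l < 0} = 2"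

text \<open>For \<open>c = 0\<close> no regularity is required: \<^const>\<open>deriv\<close> is total, and its (then possibly
  meaningless) value is multiplied by zero.\<close>

definition wave_profile ::
  "real \<Rightarrow> real \<Rightarrow> real \<Rightarrow> real \<Rightarrow> real \<Rightarrow> (real \<Rightarrow> real) \<Rightarrow> (real \<Rightarrow> real) \<Rightarrow> bool" where
  "wave_profile a d uB vB c \<Phi>u \<Phi>v \<longleftrightarrow>
     mono \<Phi>u \<and> mono \<Phi>v \<and>
     (c \<noteq> 0 \<longrightarrow> (\<forall>\<xi>. \<Phi>u field_differentiable at \<xi> \<and> \<Phi>v field_differentiable at \<xi>)) \<and>
     (\<forall>\<xi>. - c * deriv \<Phi>u \<xi> =
            d * (\<Phi>v (\<xi> - 1) - 2 * \<Phi>u \<xi> + \<Phi>v (\<xi> + 1)) + nagumo_g (\<Phi>u \<xi>) a) \<and>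
     (\<forall>\<xi>. - c * deriv \<Phi>v \<xi> =
            d * (\<Phi>u (\<xi> - 1) - 2 * \<Phi>v \<xi> + \<Phi>u (\<xi> + 1)) + nagumo_g (\<Phi>v \<xi>) a) \<and>
     (\<Phi>u \<longlongrightarrow> 0) at_bot \<and> (\<Phi>v \<longlongrightarrow> 0) at_bot \<and>
     (\<Phi>u \<longlongrightarrow> uB) at_top \<and> (\<Phi>v \<longlongrightarrow> vB) at_top"

definition is_wave_speed :: "real \<Rightarrow> real \<Rightarrow> real \<Rightarrow> real \<Rightarrow> real \<Rightarrow> bool" where
  "is_wave_speed a d uB vB c \<longleftrightarrow> (\<exists>\<Phi>u \<Phi>v. wave_profile a d uB vB c \<Phi>u \<Phi>v)"

definition u_fun :: "real \<Rightarrow> real \<Rightarrow> real \<Rightarrow> real" where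
  "u_fun a d v = v - nagumo_g v a / (2 * d)"

definition v_fun :: "real \<Rightarrow> real \<Rightarrow> real \<Rightarrow> real" where
  "v_fun a d u = u - nagumo_g u a / (2 * d)"

definition gamma_minus :: "real \<Rightarrow> real \<Rightarrow> real" where
  "gamma_minus a d = (a + 1) / 3 - sqrt (a\<^sup>2 - a + 1 - 6 * d) / 3"

definition gamma_plus :: "real \<Rightarrow> real \<Rightarrow> real" where
  "gamma_plus a d = (a + 1) / 3 + sqrt (a\<^sup>2 - a + 1 - 6 * d) / 3"

text \<open>The remaining quantities depend on \<open>(a, d)\<close> also through \<open>(u\<^sub>B, v\<^sub>B)\<close>, which is passed
  as an explicit argument.\<close>

definition v_bot :: "real \<Rightarrow> real \<Rightarrow> real \<Rightarrow> real" where
  "v_bot a d uB = (THE v. v \<in> {0<..<gamma_minus a d} \<and> u_fun a d v = uB)"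

definition u_inv :: "real \<Rightarrow> real \<Rightarrow> real \<Rightarrow> real \<Rightarrow> real" where
  "u_inv a d uB = the_inv_into {0..v_bot a d uB} (u_fun a d)"

definition u_top :: "real \<Rightarrow> real \<Rightarrow> real \<Rightarrow> real" where
  "u_top a d uB = 2 * u_fun a d (gamma_plus a d) - uB"

definition v_refl :: "real \<Rightarrow> real \<Rightarrow> real \<Rightarrow> real \<Rightarrow> real" where
  "v_refl a d vB u = 2 * v_fun a d u - vB"

text \<open>\<open>GREATEST\<close> is the maximum of the set, with no finiteness requirement as for \<^const>\<open>Max\<close>.\<close>

definition u_bot :: "real \<Rightarrow> real \<Rightarrow> real \<Rightarrow> real \<Rightarrow> real" where
  "u_bot a d uB vB = (GREATEST u. u \<in> {0..uB} \<and> v_refl a d vB u = u_inv a d uB u)"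

end

theory Submission
  imports Defs
begin

text \<open>The profile equations say that \<open>-c \<Phi>\<^sub>v'(\<xi>)\<close> is \<open>d\<close> times
  \<open>\<Phi>\<^sub>u(\<xi> - 1) + \<Phi>\<^sub>u(\<xi> + 1) - 2 u\<^sub>a\<^sub>,\<^sub>d(\<Phi>\<^sub>v(\<xi>))\<close>, and likewise with the
  components exchanged.

  If \<open>c < 0\<close>, the left-hand side is nonnegative. At a point \<open>x\<close> where \<open>\<Phi>\<^sub>v = v\<^sub>b\<^sub>o\<^sub>t\<close> both
  neighbours of \<open>\<Phi>\<^sub>u\<close> must then equal \<open>u\<^sub>B\<close>, so \<open>\<Phi>\<^sub>u\<close> is constant near \<open>x\<close>, and the other equation
  forces \<open>\<Phi>\<^sub>v(x - 1) = v\<^sub>B\<close>, contradicting \<open>\<Phi>\<^sub>v(x - 1) \<le> v\<^sub>b\<^sub>o\<^sub>t < v\<^sub>B\<close>.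

  If \<open>c = 0\<close>, choose \<open>x\<close> such that \<open>\<Phi>\<^sub>v(x - 2) \<le> \<gamma>\<^sub>- < \<Phi>\<^sub>v(x)\<close> and put \<open>u = \<Phi>\<^sub>u(x - 1)\<close>. Since
  \<open>u\<^sub>a\<^sub>,\<^sub>d\<close> is minimal at \<open>\<gamma>\<^sub>+\<close> to the right of \<open>\<gamma>\<^sub>-\<close>, the equation at \<open>x\<close> gives \<open>u\<^sub>t\<^sub>o\<^sub>p \<le> u\<close>.
  The equations at \<open>x - 2\<close> and \<open>x - 1\<close> bound \<open>\<Phi>\<^sub>v(x - 2)\<close> above by the inverse branch at \<open>u\<close> and
  below by the reflected cubic at \<open>u\<close>; as this order is reversed at \<open>u\<^sub>B\<close>, the two graphs meet in
  \<open>[u, u\<^sub>B]\<close>, whence \<open>u \<le> u\<^sub>b\<^sub>o\<^sub>t\<close>.\<close>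

section \<open>Monotone functions on the line\<close>

lemma mono_le_limit:
  fixes f :: "real \<Rightarrow> real"
  assumes "mono f" "(f \<longlongrightarrow> l) at_top"
  shows "f x \<le> l"
  using assms(2)
  by (rule tendsto_lowerbound) (auto intro: eventually_mono[OF eventually_ge_at_top[of x]] monoD[OF assms(1)])

lemma mono_ge_limit:
  fixes f :: "real \<Rightarrow> real"
  assumes "mono f" "(f \<longlongrightarrow> l) at_bot"
  shows "l \<le> f x"
  using assms(2)
  by (rule tendsto_upperbound) (auto intro: eventually_mono[OF eventually_le_at_bot[of x]] monoD[OF assms(1)])

text \<open>Samples at \<open>p + 2 * k\<close>, starting where \<open>f p < m\<close>, must cross
  the level between two consecutive ones. \<open>f\<close> may jump, as a profile with
  \<open>c = 0\<close> may.\<close>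

lemma mono_step_across_level:
  fixes f :: "real \<Rightarrow> real"
  assumes "mono f" "(f \<longlongrightarrow> l) at_bot" "(f \<longlongrightarrow> r) at_top" "l < m" "m < r"
  obtains x where "f (x - 2) \<le> m" "m < f x"
proof -
  obtain p where p: "f p < m"
    using order_tendstoD(2)[OF assms(2,4)] by (auto simp: eventually_at_bot_linorder)
  obtain q where q: "m < f q"
    using order_tendstoD(1)[OF assms(3,5)] by (auto simp: eventually_at_top_linorder)
  define P where "P k \<longleftrightarrow> m < f (p + 2 * real k)" for k
  have P: "P (nat \<lceil>\<bar>q - p\<bar>\<rceil>)"
  proof -
    have "q \<le> p + 2 * real (nat \<lceil>\<bar>q - p\<bar>\<rceil>)" by linarith
    then show ?thesis using q monoD[OF assms(1)] unfolding P_def by (meson less_le_trans)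
  qed
  obtain k where "\<not> P k" "P (Suc k)"
  proof (rule ccontr)
    assume "\<not> thesis"
    then have "\<not> P k" for k
      using that p by (induction k) (auto simp: P_def)
    with P show False by blast
  qed
  then show thesis
    by (intro that[of "p + 2 * real (Suc k)"]) (auto simp: P_def algebra_simps)
qed

lemma deriv_nonneg_of_mono:
  fixes f :: "real \<Rightarrow> real"
  assumes "mono f" "f field_differentiable at x"
  shows "0 \<le> deriv f x"
  using mono_on_imp_deriv_nonneg[of UNIV f "deriv f x" x] assms
  by (simp add: field_differentiable_derivI)

section \<open>Shape of the cubic \<open>u_fun\<close>\<close>

lemma u_fun_equilibrium:
  assumes "0 < d"
  shows "d * (p - 2 * v + q) + nagumo_g v a = d * (p + q - 2 * u_fun a d v)"
  using assms by (simp add: u_fun_def field_simps)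

lemma v_fun_eq_u_fun: "v_fun = u_fun"
  by (simp add: fun_eq_iff v_fun_def u_fun_def)

text \<open>The shift to the inflection point \<open>(a + 1) / 3\<close> removes the quadratic term
  of the cubic; the last factor carries the sign of the difference quotient.\<close>

lemma u_fun_diff:
  fixes a d v w :: real
  assumes "0 < d"
  defines "x \<equiv> \<lambda>v. v - (a + 1) / 3"
  shows "2 * d * (u_fun a d v - u_fun a d w) =
    (v - w) * ((x v)\<^sup>2 + x v * x w + (x w)\<^sup>2 - (a\<^sup>2 - a + 1 - 6 * d) / 3)"
proof -
  have "2 * d * (u_fun a d v - u_fun a d w) = 2 * d * (v - w) - nagumo_g v a + nagumo_g w a"
    using assms(1) by (simp add: u_fun_def field_simps)
  also have "\<dots> = (v - w) * ((x v)\<^sup>2 + x v * x w + (x w)\<^sup>2 - (a\<^sup>2 - a + 1 - 6 * d) / 3)"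
    unfolding nagumo_g_def x_def by (simp add: field_simps power2_eq_square)
  finally show ?thesis .
qed

lemma continuous_on_u_fun: "continuous_on A (u_fun a d)"
  unfolding u_fun_def nagumo_g_def divide_inverse by (intro continuous_intros)

locale bichromatic =
  fixes a d uB vB :: real
  assumes d_pos: "0 < d" and a_pos: "0 < a"
    and uB_pos: "0 < uB" and uB_less: "uB < a" and vB_greater: "a < vB"
    and u_fun_vB: "u_fun a d vB = uB" and v_fun_uB: "v_fun a d uB = vB"
begin

lemma u_fun_less_imp_coeff_neg:
  assumes "v < w" "u_fun a d w < u_fun a d v"
  shows "(w - (a + 1) / 3)\<^sup>2 + (w - (a + 1) / 3) * (v - (a + 1) / 3) + (v - (a + 1) / 3)\<^sup>2
    < (a\<^sup>2 - a + 1 - 6 * d) / 3" (is "?q < ?r")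
proof -
  have "2 * d * (u_fun a d w - u_fun a d v) < 0"
    using assms d_pos by (simp add: mult_pos_neg)
  then have "(w - v) * (?q - ?r) < 0"
    by (simp only: u_fun_diff[OF d_pos])
  then have "?q - ?r < 0"
    by (rule contrapos_pp) (use assms(1) in \<open>simp only: not_less, intro mult_nonneg_nonneg, simp_all\<close>)
  then show ?thesis by linarith
qed

lemma u_fun_a: "u_fun a d a = a"
  by (simp add: u_fun_def nagumo_g_def)

text \<open>Between \<open>a\<close> and \<open>vB\<close> the cubic drops from \<open>a\<close> to
  \<open>uB\<close>, so a positive semidefinite form lies strictly below a third of the
  discriminant.\<close>

lemma discriminant_pos: "0 < a\<^sup>2 - a + 1 - 6 * d"
proof -
  have "0 \<le> x\<^sup>2 + x * y + y\<^sup>2" for x y :: real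
  proof -
    have "x\<^sup>2 + x * y + y\<^sup>2 = (x + y / 2)\<^sup>2 + 3 / 4 * y\<^sup>2" by (simp add: power2_eq_square field_simps)
    then show ?thesis by simp
  qed
  with u_fun_less_imp_coeff_neg[OF vB_greater] u_fun_vB u_fun_a uB_less show ?thesis
    by (smt (verit) divide_le_0_iff)
qed

abbreviation "s \<equiv> sqrt (a\<^sup>2 - a + 1 - 6 * d)"

lemma s_pos: "0 < s" and s_square: "(a\<^sup>2 - a + 1 - 6 * d) = s\<^sup>2"
  using discriminant_pos by auto

text \<open>Expanded around \<open>gamma_minus\<close>, the second factor has only nonnegative terms
  when both arguments lie to its left.\<close>

lemma u_fun_diff_gamma:
  "2 * d * (u_fun a d v - u_fun a d w) =
    (v - w) * ((gamma_minus a d - v)\<^sup>2 + (gamma_minus a d - v) * (gamma_minus a d - w)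
      + (gamma_minus a d - w)\<^sup>2 + s * (gamma_minus a d - v + (gamma_minus a d - w)))"
proof -
  define r where "r = s"
  have "(a + 1) / 3 = gamma_minus a d + r / 3" by (simp add: gamma_minus_def r_def)
  moreover have "(a\<^sup>2 - a + 1 - 6 * d) / 3 = r\<^sup>2 / 3"
    using discriminant_pos by (simp add: r_def)
  ultimately show ?thesis
    unfolding u_fun_diff[OF d_pos] r_def[symmetric]
    by (simp only:) (simp add: power2_eq_square field_simps)
qed

lemma u_fun_strict_mono_on: "strict_mono_on {..gamma_minus a d} (u_fun a d)"
proof (rule strict_mono_onI)
  fix w v assume "w \<in> {..gamma_minus a d}" "v \<in> {..gamma_minus a d}" "w < v"
  then have "0 < 2 * d * (u_fun a d v - u_fun a d w)"
    unfolding u_fun_diff_gamma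
    using s_pos by (intro mult_pos_pos add_nonneg_pos add_nonneg_nonneg) auto
  then show "u_fun a d w < u_fun a d v" using d_pos by (simp add: zero_less_mult_iff)
qed

lemma u_fun_gamma_plus_le:
  assumes "gamma_minus a d \<le> v"
  shows "u_fun a d (gamma_plus a d) \<le> u_fun a d v"
proof -
  \<comment> \<open>\<open>gamma_plus\<close> is critical, hence a double root; the third root is
    \<open>gamma_minus a d - s / 3\<close>.\<close>
  have "2 * d * (u_fun a d v - u_fun a d (gamma_plus a d)) =
      (v - gamma_plus a d)\<^sup>2 * (v - gamma_minus a d + s / 3)"
    unfolding u_fun_diff[OF d_pos] s_square[THEN arg_cong[of _ _ "\<lambda>x. x / 3"]]
      gamma_minus_def gamma_plus_def
    by (simp add: power2_eq_square field_simps)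
  also have "\<dots> \<ge> 0" using assms s_pos by auto
  finally show ?thesis using d_pos by (simp add: zero_le_mult_iff)
qed

lemma gamma_minus_pos: "0 < gamma_minus a d"
proof -
  have "s < a + 1"
    using a_pos d_pos by (intro real_less_lsqrt) (auto simp: power2_eq_square algebra_simps)
  then show ?thesis by (simp add: gamma_minus_def)
qed

lemma gamma_minus_less_vB: "gamma_minus a d < vB"
  using strict_mono_onD[OF u_fun_strict_mono_on, of a vB] vB_greater u_fun_vB u_fun_a uB_less
  by (smt (verit) atMost_iff)

text \<open>As \<open>u_fun a d a = a > uB\<close>, it suffices that the local maximum is at least
  the value at \<open>a\<close>.\<close>

lemma uB_less_u_fun_gamma_minus: "uB < u_fun a d (gamma_minus a d)"
proof (cases "a \<le> gamma_minus a d")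
  case True
  then show ?thesis
    using strict_mono_onD[OF u_fun_strict_mono_on, of a "gamma_minus a d"] u_fun_a uB_less by force
next
  case False
  have "a \<le> gamma_plus a d"
  proof (rule ccontr)
    \<comment> \<open>Beyond \<open>gamma_plus\<close> the cubic increases, which excludes the drop
      from \<open>a\<close> to \<open>vB\<close>.\<close>
    assume "\<not> a \<le> gamma_plus a d"
    then have "s / 3 \<le> a - (a + 1) / 3" "s / 3 \<le> vB - (a + 1) / 3"
      using vB_greater unfolding gamma_plus_def by linarith+
    then have "(s / 3)\<^sup>2 + s / 3 * (s / 3) + (s / 3)\<^sup>2 \<le> (vB - (a + 1) / 3)\<^sup>2
        + (vB - (a + 1) / 3) * (a - (a + 1) / 3) + (a - (a + 1) / 3)\<^sup>2"
      using s_pos by (intro add_mono mult_mono power_mono; linarith)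
    moreover have "(s / 3)\<^sup>2 + s / 3 * (s / 3) + (s / 3)\<^sup>2 = (a\<^sup>2 - a + 1 - 6 * d) / 3"
      unfolding s_square[THEN arg_cong[of _ _ "\<lambda>x. x / 3"]] by (simp add: power2_eq_square)
    ultimately show False
      using u_fun_less_imp_coeff_neg[OF vB_greater] u_fun_vB u_fun_a uB_less by simp
  qed
  then have y: "0 \<le> a - gamma_minus a d" "a - gamma_minus a d \<le> s"
    using False s_pos by (auto simp: gamma_minus_def gamma_plus_def)
  have "2 * d * (u_fun a d a - u_fun a d (gamma_minus a d)) =
      (a - gamma_minus a d)\<^sup>2 * (a - gamma_minus a d - s)"
    unfolding u_fun_diff_gamma by (simp add: power2_eq_square algebra_simps)
  also have "\<dots> \<le> 0" using y by (intro mult_nonneg_nonpos) auto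
  finally show ?thesis using d_pos u_fun_a uB_less by (simp add: mult_le_0_iff)
qed

section \<open>The inverse branch and its crossings with the reflected cubic\<close>

lemma v_bot: "0 < v_bot a d uB" "v_bot a d uB < gamma_minus a d" "u_fun a d (v_bot a d uB) = uB"
proof -
  have "u_fun a d 0 = 0" by (simp add: u_fun_def nagumo_g_def)
  then obtain v where v: "0 \<le> v" "v \<le> gamma_minus a d" "u_fun a d v = uB"
    using IVT'[of "u_fun a d" 0 uB "gamma_minus a d"] uB_pos uB_less_u_fun_gamma_minus gamma_minus_pos
      continuous_on_u_fun by force
  then have "v \<in> {0<..<gamma_minus a d} \<and> u_fun a d v = uB"
    using uB_pos uB_less_u_fun_gamma_minus \<open>u_fun a d 0 = 0\<close> by (auto simp: less_le)
  then have "\<exists>!v. v \<in> {0<..<gamma_minus a d} \<and> u_fun a d v = uB"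
    using inj_onD[OF strict_mono_on_imp_inj_on[OF u_fun_strict_mono_on]] by force
  then have "v_bot a d uB \<in> {0<..<gamma_minus a d} \<and> u_fun a d (v_bot a d uB) = uB"
    unfolding v_bot_def by (rule theI')
  then show "0 < v_bot a d uB" "v_bot a d uB < gamma_minus a d" "u_fun a d (v_bot a d uB) = uB"
    by auto
qed

lemma u_fun_inj_on: "inj_on (u_fun a d) {0..v_bot a d uB}"
  by (rule inj_on_subset[OF strict_mono_on_imp_inj_on[OF u_fun_strict_mono_on]])
    (use v_bot(2) in auto)

lemma u_inv_u_fun: "v \<in> {0..v_bot a d uB} \<Longrightarrow> u_inv a d uB (u_fun a d v) = v"
  unfolding u_inv_def by (rule the_inv_into_f_f[OF u_fun_inj_on])

lemma u_fun_image: "u_fun a d ` {0..v_bot a d uB} = {0..uB}"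
proof (rule set_eqI)
  fix u
  have 0: "u_fun a d 0 = 0" by (simp add: u_fun_def nagumo_g_def)
  have mono: "u_fun a d v \<le> u_fun a d w" if "v \<le> w" "w \<le> v_bot a d uB" for v w
    using strict_mono_on_leD[OF u_fun_strict_mono_on, of v w] that v_bot(2) by auto
  show "u \<in> u_fun a d ` {0..v_bot a d uB} \<longleftrightarrow> u \<in> {0..uB}"
    using mono[of 0] mono[of _ "v_bot a d uB"] v_bot 0
      IVT'[of "u_fun a d" 0 u "v_bot a d uB"] continuous_on_u_fun by fastforce
qed

lemma u_inv_uB: "u_inv a d uB uB = v_bot a d uB"
  using u_inv_u_fun[of "v_bot a d uB"] v_bot by simp

lemma continuous_on_u_inv: "continuous_on {0..uB} (u_inv a d uB)"
  using continuous_on_inv[OF continuous_on_u_fun compact_Icc, where g = "u_inv a d uB"]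
    u_inv_u_fun unfolding u_fun_image[symmetric] by blast

lemma le_u_bot:
  assumes "0 \<le> u" "u \<le> uB" "v_refl a d vB u \<le> u_inv a d uB u"
  shows "u \<le> u_bot a d uB vB"
proof -
  define h where "h w = v_refl a d vB w - u_inv a d uB w" for w
  have h: "continuous_on {0..uB} h"
    unfolding h_def v_refl_def v_fun_eq_u_fun
    by (intro continuous_intros continuous_on_u_fun continuous_on_u_inv)
  \<comment> \<open>At \<open>uB\<close> the reflected cubic equals \<open>vB\<close>, the inverse
    branch \<open>v_bot a d uB < vB\<close>.\<close>
  have "0 \<le> h uB"
    using v_bot(2) gamma_minus_less_vB by (simp add: h_def v_refl_def v_fun_uB u_inv_uB)
  then obtain z where z: "u \<le> z" "z \<le> uB" "h z = 0"
    using IVT'[of h u 0 uB] assms continuous_on_subset[OF h, of "{u..uB}"] by (auto simp: h_def)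
  \<comment> \<open>Compactness yields a largest crossing, which gives \<open>GREATEST\<close> its
    meaning.\<close>
  have "compact {w \<in> {0..uB}. h w = 0}"
    using continuous_closed_preimage_constant[OF h, of 0]
    by (metis (no_types, lifting) bounded_closed_interval bounded_subset closed_atLeastAtMost
        compact_eq_bounded_closed mem_Collect_eq subsetI)
  then obtain t where t: "t \<in> {0..uB}" "h t = 0" "\<And>w. w \<in> {0..uB} \<Longrightarrow> h w = 0 \<Longrightarrow> w \<le> t"
    using compact_attains_sup[of "{w \<in> {0..uB}. h w = 0}"] z assms(1) by force
  then have "u_bot a d uB vB = t"
    unfolding u_bot_def by (intro Greatest_equality) (auto simp: h_def)
  then show ?thesis using t(3)[of z] z assms(1) by simp
qed

section \<open>Excluding \<open>c < 0\<close> and \<open>c = 0\<close>\<close>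

lemma wave_speed_nonneg:
  assumes "wave_profile a d uB vB c \<Phi>u \<Phi>v"
  shows "0 \<le> c"
proof (rule ccontr)
  assume "\<not> 0 \<le> c"
  then have c: "c < 0" by simp
  have mono: "mono \<Phi>u" "mono \<Phi>v"
    and diff: "\<And>\<xi>. \<Phi>u field_differentiable at \<xi>" "\<And>\<xi>. \<Phi>v field_differentiable at \<xi>"
    and equ: "\<And>\<xi>. - c * deriv \<Phi>u \<xi> = d * (\<Phi>v (\<xi> - 1) + \<Phi>v (\<xi> + 1) - 2 * v_fun a d (\<Phi>u \<xi>))"
    and eqv: "\<And>\<xi>. - c * deriv \<Phi>v \<xi> = d * (\<Phi>u (\<xi> - 1) + \<Phi>u (\<xi> + 1) - 2 * u_fun a d (\<Phi>v \<xi>))"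
    and lim: "(\<Phi>v \<longlongrightarrow> 0) at_bot" "(\<Phi>u \<longlongrightarrow> uB) at_top" "(\<Phi>v \<longlongrightarrow> vB) at_top"
    using assms c by (auto simp: wave_profile_def u_fun_equilibrium[OF d_pos] v_fun_eq_u_fun)
  have ub: "\<Phi>u \<xi> \<le> uB" "\<Phi>v \<xi> \<le> vB" for \<xi>
    using mono lim by (auto intro: mono_le_limit)
  obtain p where p: "\<Phi>v p < v_bot a d uB"
    using order_tendstoD(2)[OF lim(1) v_bot(1)] by (auto simp: eventually_at_bot_linorder)
  have "v_bot a d uB < vB" using v_bot(2) gamma_minus_less_vB by simp
  then obtain q where q: "v_bot a d uB < \<Phi>v q"
    using order_tendstoD(1)[OF lim(3)] by (auto simp: eventually_at_top_linorder)
  have "p \<le> q" using p q monoD[OF mono(2), of q p] by linarith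
  moreover have "continuous_on {p..q} \<Phi>v"
    using diff(2) by (intro continuous_at_imp_continuous_on ballI field_differentiable_imp_continuous_at)
  ultimately obtain x where x: "\<Phi>v x = v_bot a d uB"
    using IVT'[of \<Phi>v p _ q] p q by (auto dest: less_imp_le)
  have "0 \<le> - c * deriv \<Phi>v x"
    using c deriv_nonneg_of_mono[OF mono(2) diff(2)] by (simp add: mult_nonpos_nonneg)
  then have "2 * uB \<le> \<Phi>u (x - 1) + \<Phi>u (x + 1)"
    unfolding eqv x v_bot(3) using d_pos by (simp add: zero_le_mult_iff)
  then have "\<Phi>u (x - 1) = uB" using ub(1)[of "x - 1"] ub(1)[of "x + 1"] by linarith
  \<comment> \<open>\<open>\<Phi>u\<close> has reached its upper bound at \<open>x - 1\<close> and
    stays there, so its derivative at the interior point \<open>x\<close> vanishes.\<close>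
  then have const: "\<Phi>u y = uB" if "x - 1 \<le> y" for y
    using monoD[OF mono(1) that] ub(1)[of y] by simp
  have "deriv \<Phi>u x = deriv (\<lambda>_. uB) x"
    by (intro deriv_cong_ev refl eventually_mono[OF eventually_nhds_in_open[of "{x - 1<..}"]])
      (auto intro: const)
  then have "\<Phi>v (x - 1) + \<Phi>v (x + 1) = 2 * vB"
    using equ[of x] const[of x] d_pos by (simp add: v_fun_uB)
  moreover have "\<Phi>v (x - 1) \<le> v_bot a d uB" using monoD[OF mono(2), of "x - 1" x] x by simp
  ultimately show False using ub(2)[of "x + 1"] \<open>v_bot a d uB < vB\<close> by linarith
qed

lemma u_top_le_u_bot:
  assumes "wave_profile a d uB vB 0 \<Phi>u \<Phi>v"
  shows "u_top a d uB \<le> u_bot a d uB vB"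
proof -
  have mono: "mono \<Phi>u" "mono \<Phi>v"
    and equ: "\<And>\<xi>. \<Phi>v (\<xi> - 1) + \<Phi>v (\<xi> + 1) = 2 * v_fun a d (\<Phi>u \<xi>)"
    and eqv: "\<And>\<xi>. \<Phi>u (\<xi> - 1) + \<Phi>u (\<xi> + 1) = 2 * u_fun a d (\<Phi>v \<xi>)"
    and lim: "(\<Phi>u \<longlongrightarrow> 0) at_bot" "(\<Phi>v \<longlongrightarrow> 0) at_bot"
      "(\<Phi>u \<longlongrightarrow> uB) at_top" "(\<Phi>v \<longlongrightarrow> vB) at_top"
    using assms d_pos by (auto simp: wave_profile_def u_fun_equilibrium[OF d_pos] v_fun_eq_u_fun)
  have bd: "0 \<le> \<Phi>u \<xi>" "0 \<le> \<Phi>v \<xi>" "\<Phi>u \<xi> \<le> uB" "\<Phi>v \<xi> \<le> vB" for \<xi>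
    using mono lim by (auto intro: mono_le_limit mono_ge_limit)
  \<comment> \<open>The step is 2 because \<open>x - 2\<close> and \<open>x\<close> are the
    neighbours of \<open>x - 1\<close> in \<open>equ\<close>.\<close>
  obtain x where x: "\<Phi>v (x - 2) \<le> gamma_minus a d" "gamma_minus a d < \<Phi>v x"
    using mono_step_across_level[OF mono(2) lim(2,4) gamma_minus_pos gamma_minus_less_vB] .
  define u where "u = \<Phi>u (x - 1)"
  have u: "0 \<le> u" "u \<le> uB" by (simp_all add: u_def bd)
  have "u_top a d uB \<le> u"
    using u_fun_gamma_plus_le[of "\<Phi>v x"] x(2) eqv[of x] bd(3)[of "x + 1"] by (simp add: u_top_def u_def)
  moreover have "v_refl a d vB u \<le> u_inv a d uB u"
  proof -
    obtain w where w: "w \<in> {0..v_bot a d uB}" "u_fun a d w = u"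
      using u u_fun_image by (metis atLeastAtMost_iff image_iff)
    have "2 * u_fun a d (\<Phi>v (x - 2)) \<le> 2 * u"
      using eqv[of "x - 2"] monoD[OF mono(1), of "x - 3" "x - 1"] by (simp add: u_def)
    then have "\<Phi>v (x - 2) \<le> w"
      using strict_mono_onD[OF u_fun_strict_mono_on, of w "\<Phi>v (x - 2)"] x(1) w v_bot(2) by force
    \<comment> \<open>By \<open>equ\<close>,
      \<open>v_refl a d vB u = \<Phi>v (x - 2) + \<Phi>v x - vB\<close>, and
      \<open>\<Phi>v x \<le> vB\<close>.\<close>
    moreover have "v_refl a d vB u \<le> \<Phi>v (x - 2)"
      using equ[of "x - 1"] bd(4)[of x] by (simp add: v_refl_def u_def)
    ultimately show ?thesis using u_inv_u_fun[OF w(1)] w(2) by simp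
  qed
  ultimately show ?thesis using le_u_bot[OF u] by linarith
qed

end

lemma bichromatic_uv_B:
  assumes "(a, d) \<in> Omega_minus" "is_uv_B a d uB vB"
  shows "bichromatic a d uB vB"
proof
  show "0 < d" "0 < a" using assms(1) by (auto simp: Omega_minus_def)
  then show "0 < uB" "uB < a" "a < vB" "u_fun a d vB = uB" "v_fun a d uB = vB"
    using assms(2)
    by (auto simp: is_uv_B_def nagumo_G_def vec_eq_iff forall_2 u_fun_def v_fun_def field_simps)
qed

theorem lemma4p9:
  fixes a d uB vB c :: real
  assumes "(a, d) \<in> Omega_minus"
    and "is_uv_B a d uB vB"
    and "is_wave_speed a d uB vB c"
    and "u_bot a d uB vB < u_top a d uB"
  shows "c > 0"
proof -
  interpret bichromatic a d uB vB using assms(1,2) by (rule bichromatic_uv_B)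
  obtain \<Phi>u \<Phi>v where "wave_profile a d uB vB c \<Phi>u \<Phi>v"
    using assms(3) by (auto simp: is_wave_speed_def)
  with wave_speed_nonneg u_top_le_u_bot assms(4) show ?thesis
    by (metis less_le not_less)
qed

end
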